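(* Let $A$ be an $n\times n$ consensus matrix whose communication graph has connectivity $k$, let $m=\lfloor\frac{k-1}{2}\rfloor+1$, and let $\mathcal{K}$ be a family of subsets of $V=\{1,\dots,n\}$ containing all subsets of cardinality $m$. Then there exist a set $K_1\subseteq V$ with $|K_1|=m$ and an input $u_{K_1}:\mathbb{N}\to\mathbb{R}^{m}$ for the system $x(t+1)=Ax(t)+B_{K_1}u_{K_1}(t)$ which is unidentifiable and for which all agents in $K_1$ are misbehaving.
   Context: $\mathbb{N}=\{0,1,2,\dots\}$. A consensus matrix is a real square matrix that is row stochastic (nonnegative entries, rows summing to one) and primitive. Its communication graph is the directed graph on $V=\{1,\dots,n\}$ with edge $(j,i)$ if and only if $A_{ij}\neq 0$; the neighbor set of $j$ is $N_j=\{i\in V:(i,j)\in E\}$. A vertex cutset is a set $S\subset V$ such that $V\setminus S$ can be partitioned into two nonempty sets $V_1,V_3$ with no edge from $V_3$ to $V_1$; the connectivity of the graph is the minimum number of vertices in a vertex cutset (in particular such a cutset exists). For $K=\{i_1,i_2,\dots\}\subseteq V$, $B_K=[e_{i_1}\ e_{i_2}\ \cdots]$ with $e_i$ the canonical basis vectors. For $j\in V$ with $N_j=\{n_1,\dots,n_p\}$, $C_j=[e_{n_1}\ \cdots\ e_{n_p}]^{\mathsf T}$, and $y_j(x_0,u_K,t)=C_jx(t)$ is the output of node $j$ at time $t$ for $x(t+1)=Ax(t)+B_Ku_K(t)$, $x(0)=x_0$. For nonempty $K_1\in\mathcal{K}$, an input $u_{K_1}$ is unidentifiable if there exist $K_2\in\mathcal{K}$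 with $K_2\neq K_1$, an input $u_{K_2}$, $x_1,x_2\in\mathbb{R}^n$ and $j\in V$ with $y_j(x_1,u_{K_1},t)=y_j(x_2,u_{K_2},t)$ for all $t\in\mathbb{N}$. An agent $i\in K_1$ is misbehaving if its input component $u_i(t)$ is nonzero for some $t\in\mathbb{N}$. *)

theory Defs
  imports
    Complex_Main
    "Jordan_Normal_Form.Matrix"
    "Graph_Theory.Pair_Digraph"
begin

text \<open>
  Indices of matrices and vectors start at 0, so the agents \<open>1, \<dots>, n\<close> are rendered
  as \<open>{0..<n}\<close>.
\<close>

definition row_stochastic :: "real mat \<Rightarrow> bool" where
  "row_stochastic A \<longleftrightarrow>
     (\<forall>i<dim_row A. \<forall>j<dim_col A. 0 \<le> A $$ (i, j)) \<and>
     (\<forall>i<dim_row A. (\<Sum>j<dim_col A. A $$ (i, j)) = 1)"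

definition primitive_mat :: "real mat \<Rightarrow> bool" where
  "primitive_mat A \<longleftrightarrow>
     square_mat A \<and>
     (\<forall>i<dim_row A. \<forall>j<dim_row A. 0 \<le> A $$ (i, j)) \<and>
     (\<exists>h>0. \<forall>i<dim_row A. \<forall>j<dim_row A. 0 < (A ^\<^sub>m h) $$ (i, j))"

definition consensus_mat :: "nat \<Rightarrow> real mat \<Rightarrow> bool" where
  "consensus_mat n A \<longleftrightarrow> A \<in> carrier_mat n n \<and> row_stochastic A \<and> primitive_mat A"

definition comm_graph :: "real mat \<Rightarrow> nat pair_pre_digraph" where
  "comm_graph A =
     \<lparr> pverts = {0..<dim_row A},
       parcs = {(j, i). j < dim_row A \<and> i < dim_row A \<and> A $$ (i, j) \<noteq> 0} \<rparr>"

definition neighbors :: "'a pair_pre_digraph \<Rightarrow> 'a \<Rightarrow> 'a set" where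
  "neighbors G j = {i \<in> pverts G. (i, j) \<in> parcs G}"

definition vertex_cutset :: "'a pair_pre_digraph \<Rightarrow> 'a set \<Rightarrow> bool" where
  "vertex_cutset G S \<longleftrightarrow>
     S \<subseteq> pverts G \<and>
     (\<exists>V1 V3. V1 \<noteq> {} \<and> V3 \<noteq> {} \<and> V1 \<inter> V3 = {} \<and> V1 \<union> V3 = pverts G - S \<and>
        (\<forall>v\<in>V3. \<forall>w\<in>V1. (v, w) \<notin> parcs G))"

text \<open>A relation rather than a function, since a graph need not have any vertex cutset.\<close>

definition has_connectivity :: "'a pair_pre_digraph \<Rightarrow> nat \<Rightarrow> bool" where
  "has_connectivity G k \<longleftrightarrow>
     (\<exists>S. vertex_cutset G S \<and> card S = k) \<and> (\<forall>S. vertex_cutset G S \<longrightarrow> k \<le> card S)"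

text \<open>
  The canonical basis vectors indexed by a finite set are arranged in increasing order of the
  index; component \<open>p\<close> of an input for \<open>K\<close> thus belongs to the agent
  \<open>sorted_list_of_set K ! p\<close>.
\<close>

definition basis_list :: "nat \<Rightarrow> nat set \<Rightarrow> real vec list" where
  "basis_list n K = map (unit_vec n) (sorted_list_of_set K)"

definition input_mat :: "nat \<Rightarrow> nat set \<Rightarrow> real mat" where
  "input_mat n K = mat_of_cols n (basis_list n K)"

definition output_mat :: "real mat \<Rightarrow> nat \<Rightarrow> real mat" where
  "output_mat A j = mat_of_rows (dim_row A) (basis_list (dim_row A) (neighbors (comm_graph A) j))"

definition is_input :: "nat set \<Rightarrow> (nat \<Rightarrow> real vec) \<Rightarrow> bool" where
  "is_input K u \<longleftrightarrow> (\<forall>t. u t \<in> carrier_vec (card K))"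

primrec state :: "real mat \<Rightarrow> nat set \<Rightarrow> real vec \<Rightarrow> (nat \<Rightarrow> real vec) \<Rightarrow> nat \<Rightarrow> real vec" where
  "state A K x0 u 0 = x0"
| "state A K x0 u (Suc t) = A *\<^sub>v state A K x0 u t + input_mat (dim_row A) K *\<^sub>v u t"

definition node_output ::
  "real mat \<Rightarrow> nat \<Rightarrow> nat set \<Rightarrow> real vec \<Rightarrow> (nat \<Rightarrow> real vec) \<Rightarrow> nat \<Rightarrow> real vec" where
  "node_output A j K x0 u t = output_mat A j *\<^sub>v state A K x0 u t"

definition unidentifiable ::
  "real mat \<Rightarrow> nat set set \<Rightarrow> nat set \<Rightarrow> (nat \<Rightarrow> real vec) \<Rightarrow> bool" where
  "unidentifiable A \<K> K1 u1 \<longleftrightarrow>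
     K1 \<in> \<K> \<and> K1 \<noteq> {} \<and> is_input K1 u1 \<and>
     (\<exists>K2\<in>\<K>. K2 \<noteq> K1 \<and>
       (\<exists>u2 x1 x2 j. is_input K2 u2 \<and>
          x1 \<in> carrier_vec (dim_row A) \<and> x2 \<in> carrier_vec (dim_row A) \<and>
          j \<in> pverts (comm_graph A) \<and>
          (\<forall>t. node_output A j K1 x1 u1 t = node_output A j K2 x2 u2 t)))"

definition misbehaving :: "nat set \<Rightarrow> (nat \<Rightarrow> real vec) \<Rightarrow> nat \<Rightarrow> bool" where
  "misbehaving K u i \<longleftrightarrow>
     (\<exists>p<card K. sorted_list_of_set K ! p = i \<and> (\<exists>t. u t $ p \<noteq> 0))"

end

(* Feed the agents of a minimum cutset S exactly the inputs that cancel the influence of V3 on S: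
   a motion started inside V3 then stays inside V3 and cannot be seen from any node of V1.  Since
   card S \<le> 2 m, this family of inputs splits between two sets K1, K2 of cardinality m, and by
   linearity node j in V1 confuses the input on K1 with the negated input on K2.  Minimality of S
   gives every agent of S an in-neighbor in V3, so starting from the indicator vector of V3 makes
   all inputs on S nonzero at time 0. *)
theory Submission
  imports Defs "HOL-Library.Indicator_Function"
begin

section \<open>Inputs and outputs in terms of agents instead of list positions\<close>

lemma sum_nth_sorted_list_of_set:
  fixes g :: "nat \<Rightarrow> real"
  assumes "finite K"
  shows "(\<Sum>p = 0..<card K. g (sorted_list_of_set K ! p)) = sum g K"
proof -
  have "bij_betw (\<lambda>p. sorted_list_of_set K ! p) {..<card K} K"
    using assms by (intro bij_betw_nth) auto
  from sum.reindex_bij_betw[OF this, of g] show ?thesis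
    by (simp add: atLeast0LessThan)
qed

lemma sorted_list_of_set_nth_mem:
  assumes "finite K" "p < card K"
  shows "sorted_list_of_set K ! p \<in> K"
  using assms by (metis length_sorted_list_of_set nth_mem set_sorted_list_of_set)

text \<open>Packs an input indexed by agents into the coordinates fixed by the sorted list of
  \<open>K\<close>. Values of \<open>f\<close> outside \<open>K\<close> are ignored, so one formula
  can serve several sets.\<close>

definition input_of :: "nat set \<Rightarrow> (nat \<Rightarrow> nat \<Rightarrow> real) \<Rightarrow> nat \<Rightarrow> real vec" where
  "input_of K f t = vec (card K) (\<lambda>p. f t (sorted_list_of_set K ! p))"

lemma is_input_input_of: "is_input K (input_of K f)"
  by (simp add: is_input_def input_of_def)

lemma misbehaving_input_of:
  assumes "finite K" "i \<in> K" "f t i \<noteq> 0"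
  shows "misbehaving K (input_of K f) i"
proof -
  obtain p where p: "p < card K" "sorted_list_of_set K ! p = i"
    using assms(1,2) by (metis in_set_conv_nth length_sorted_list_of_set set_sorted_list_of_set)
  then show ?thesis
    using assms(3) unfolding misbehaving_def input_of_def
    by (intro exI[of _ p]) auto
qed

lemma dim_input_mat [simp]: "dim_row (input_mat n K) = n" "dim_col (input_mat n K) = card K"
  by (simp_all add: input_mat_def basis_list_def)

lemma input_mat_mult_input_of:
  assumes K: "K \<subseteq> {0..<n}" and i: "i < n"
  shows "(input_mat n K *\<^sub>v input_of K f t) $ i = (if i \<in> K then f t i else 0)"
proof -
  have fin: "finite K" using K finite_subset by blast
  have "(input_mat n K *\<^sub>v input_of K f t) $ i
    = (\<Sum>p = 0..<card K. input_mat n K $$ (i, p) * f t (sorted_list_of_set K ! p))"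
    using i by (simp add: scalar_prod_def input_of_def)
  also have "\<dots> = (\<Sum>p = 0..<card K. (\<lambda>j. if i = j then f t j else 0) (sorted_list_of_set K ! p))"
  proof (rule sum.cong)
    fix p assume "p \<in> {0..<card K}"
    then have p: "p < card K" by simp
    then have "sorted_list_of_set K ! p < n"
      using sorted_list_of_set_nth_mem[OF fin] K by (meson atLeastLessThan_iff subsetD)
    then show "input_mat n K $$ (i, p) * f t (sorted_list_of_set K ! p)
      = (\<lambda>j. if i = j then f t j else 0) (sorted_list_of_set K ! p)"
      using i p by (simp add: input_mat_def basis_list_def mat_of_cols_index)
  qed simp
  also have "\<dots> = (\<Sum>j\<in>K. if i = j then f t j else 0)"
    by (rule sum_nth_sorted_list_of_set[OF fin])
  also have "\<dots> = (if i \<in> K then f t i else 0)"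
    using fin by simp
  finally show ?thesis .
qed

text \<open>The rows of the output matrix are unit vectors, so the output of \<open>j\<close> merely
  lists the state entries at its in-neighbors.\<close>

lemma node_output_eqI:
  assumes "\<And>i. i \<in> neighbors (comm_graph A) j \<Longrightarrow> state A K1 x1 u1 t $ i = state A K2 x2 u2 t $ i"
    and dims: "dim_vec (state A K1 x1 u1 t) = dim_row A" "dim_vec (state A K2 x2 u2 t) = dim_row A"
  shows "node_output A j K1 x1 u1 t = node_output A j K2 x2 u2 t"
proof -
  define N where "N = neighbors (comm_graph A) j"
  have N: "finite N" "N \<subseteq> {0..<dim_row A}"
    unfolding N_def neighbors_def comm_graph_def by auto
  have row: "row (output_mat A j) p = unit_vec (dim_row A) (sorted_list_of_set N ! p)"
    if "p < card N" for p
    using that N(1) by (simp add: output_mat_def basis_list_def N_def[symmetric])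
  have dim: "dim_row (output_mat A j) = card N"
    by (simp add: output_mat_def basis_list_def N_def)
  have nth: "(output_mat A j *\<^sub>v x) $ p = x $ (sorted_list_of_set N ! p)"
    if p: "p < card N" and x: "dim_vec x = dim_row A" for x p
  proof -
    have lt: "sorted_list_of_set N ! p < dim_row A"
      using sorted_list_of_set_nth_mem[OF N(1) p] N(2) by auto
    have "(output_mat A j *\<^sub>v x) $ p = row (output_mat A j) p \<bullet> x"
      using p dim by (intro index_mult_mat_vec) simp
    also have "\<dots> = x $ (sorted_list_of_set N ! p)"
      unfolding row[OF p] using lt by (rule scalar_prod_left_unit[OF carrier_vecI[OF x]])
    finally show ?thesis .
  qed
  show ?thesis
    unfolding node_output_def
  proof (rule eq_vecI)
    fix p assume "p < dim_vec (output_mat A j *\<^sub>v state A K2 x2 u2 t)"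
    then have p: "p < card N" using dim by simp
    show "(output_mat A j *\<^sub>v state A K1 x1 u1 t) $ p = (output_mat A j *\<^sub>v state A K2 x2 u2 t) $ p"
      unfolding nth[OF p dims(1)] nth[OF p dims(2)]
      using sorted_list_of_set_nth_mem[OF N(1) p] unfolding N_def by (rule assms(1))
  qed simp
qed

section \<open>Motion confined to one side of the cut\<close>

text \<open>The orbit of the indicator of \<open>W\<close> under \<open>A\<close> with all entries
  outside \<open>W\<close> erased after each step. Inputs on the cutset will do this
  erasing.\<close>

primrec confined_motion :: "real mat \<Rightarrow> nat set \<Rightarrow> nat \<Rightarrow> real vec" where
  "confined_motion A W 0 = vec (dim_row A) (indicator W)"
| "confined_motion A W (Suc t) =
     vec (dim_row A) (\<lambda>i. if i \<in> W then (A *\<^sub>v confined_motion A W t) $ i else 0)"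

lemma dim_confined_motion [simp]: "dim_vec (confined_motion A W t) = dim_row A"
  by (cases t) auto

lemma confined_motion_outside:
  "i < dim_row A \<Longrightarrow> i \<notin> W \<Longrightarrow> confined_motion A W t $ i = 0"
  by (cases t) auto

lemma state_dim:
  assumes "dim_vec x0 = dim_row A"
  shows "dim_vec (state A K x0 u t) = dim_row A"
  using assms by (cases t) auto

lemma mult_mat_vec_zero_entry:
  fixes A :: "real mat"
  assumes "A \<in> carrier_mat n n" "i < n" "dim_vec x = n"
    and "\<And>l. l < n \<Longrightarrow> A $$ (i, l) = 0 \<or> x $ l = 0"
  shows "(A *\<^sub>v x) $ i = 0"
  using assms by (auto simp: scalar_prod_def intro!: sum.neutral)

text \<open>The difference of the two states obeys the recursion of the confined motion
  \<open>z\<close>. It is driven by \<open>f1\<close> on \<open>K1\<close> and by minus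
  \<open>f2\<close> on \<open>S - K1\<close>, which together give \<open>- A z\<close> on all of
  \<open>S\<close>. On \<open>V1\<close> nothing has to be cancelled, and agents of
  \<open>K2\<close> outside \<open>S - K1\<close> stay idle.\<close>

lemma state_diff_eq_confined_motion:
  fixes A :: "real mat"
  assumes A: "A \<in> carrier_mat n n"
    and S: "S \<subseteq> {0..<n}" and part: "V1 \<inter> W = {}" "V1 \<union> W = {0..<n} - S"
    and noedge: "\<And>v w. v \<in> W \<Longrightarrow> w \<in> V1 \<Longrightarrow> A $$ (w, v) = 0"
    and K1: "K1 \<subseteq> S" and K2: "S - K1 \<subseteq> K2" "K2 \<subseteq> {0..<n}"
    and f1: "f1 = (\<lambda>t i. - (A *\<^sub>v confined_motion A W t) $ i)"
    and f2: "f2 = (\<lambda>t i. if i \<in> S - K1 then (A *\<^sub>v confined_motion A W t) $ i else 0)"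
    and i: "i < n"
  shows "state A K1 (vec n (indicator W)) (input_of K1 f1) t $ i =
    state A K2 (0\<^sub>v n) (input_of K2 f2) t $ i + confined_motion A W t $ i"
  using i
proof (induction t arbitrary: i)
  case 0
  then show ?case using A by simp
next
  case (Suc t)
  let ?z = "confined_motion A W t"
  let ?s1 = "state A K1 (vec n (indicator W)) (input_of K1 f1)"
  let ?s2 = "state A K2 (0\<^sub>v n) (input_of K2 f2)"
  have dA: "dim_row A = n" "dim_col A = n" using A by auto
  have d: "dim_vec (?s1 t) = n" "dim_vec (?s2 t) = n" "dim_vec ?z = n"
    using A by (simp_all add: state_dim)
  have "?s1 t = ?s2 t + ?z"
    using d Suc.IH by (intro eq_vecI) auto
  then have lin: "A *\<^sub>v ?s1 t = A *\<^sub>v ?s2 t + A *\<^sub>v ?z"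
    using A d by (metis carrier_vecI mult_add_distrib_mat_vec)
  have B1: "(input_mat n K1 *\<^sub>v input_of K1 f1 t) $ i = (if i \<in> K1 then f1 t i else 0)"
    using K1 S Suc.prems by (intro input_mat_mult_input_of) auto
  have B2: "(input_mat n K2 *\<^sub>v input_of K2 f2 t) $ i = (if i \<in> K2 then f2 t i else 0)"
    using K2 Suc.prems by (intro input_mat_mult_input_of) auto
  \<comment> \<open>In a row of \<open>V1\<close>, the columns in \<open>W\<close> carry zero
    coefficients, and in all other columns \<open>z\<close> itself vanishes.\<close>
  have V1: "(A *\<^sub>v ?z) $ i = 0" if "i \<in> V1"
  proof (rule mult_mat_vec_zero_entry[OF A Suc.prems d(3)])
    fix l assume "l < n"
    then show "A $$ (i, l) = 0 \<or> ?z $ l = 0"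
      using noedge[OF _ that] confined_motion_outside[of l A W t] dA by auto
  qed
  have cover: "i \<in> V1 \<union> W \<union> S" using part Suc.prems by auto
  have disj: "\<not> (i \<in> W \<and> i \<in> S)" "\<not> (i \<in> V1 \<and> i \<in> S)" "\<not> (i \<in> V1 \<and> i \<in> W)"
    using part by auto
  have "?s1 (Suc t) $ i = (A *\<^sub>v ?s2 t) $ i + (A *\<^sub>v ?z) $ i + (if i \<in> K1 then f1 t i else 0)"
    using B1 lin Suc.prems dA by simp
  moreover have "?s2 (Suc t) $ i = (A *\<^sub>v ?s2 t) $ i + (if i \<in> K2 then f2 t i else 0)"
    using B2 Suc.prems dA by simp
  moreover have "confined_motion A W (Suc t) $ i = (if i \<in> W then (A *\<^sub>v ?z) $ i else 0)"
    using Suc.prems dA by simp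
  \<comment> \<open>The balance of one step: on \<open>K1\<close> both sides are 0, on
    \<open>S - K1\<close> and on \<open>W\<close> both are \<open>A z\<close>, and on
    \<open>V1\<close> both vanish.\<close>
  moreover have "(A *\<^sub>v ?z) $ i + (if i \<in> K1 then f1 t i else 0)
      = (if i \<in> K2 then f2 t i else 0) + (if i \<in> W then (A *\<^sub>v ?z) $ i else 0)"
    using V1 cover disj K1 K2 unfolding f1 f2 by (cases "i \<in> S"; cases "i \<in> K1") auto
  ultimately show ?case by linarith
qed

section \<open>Cutsets, primitivity and minimality\<close>

text \<open>Powers inherit the zero block: in each term of the product, \<open>l\<close> in
  \<open>V1\<close> kills the factor \<open>A $$ (l, v)\<close>, and \<open>l\<close> in
  \<open>W\<close> kills the other factor by induction.\<close>

lemma pow_mat_reducible_entry_zero: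
  fixes A :: "real mat"
  assumes A: "A \<in> carrier_mat n n" and part: "V1 \<inter> W = {}" "V1 \<union> W = {0..<n}"
    and noedge: "\<And>v w. v \<in> W \<Longrightarrow> w \<in> V1 \<Longrightarrow> A $$ (w, v) = 0"
    and w: "w \<in> V1" and "v \<in> W"
  shows "(A ^\<^sub>m h) $$ (w, v) = 0"
  using \<open>v \<in> W\<close>
proof (induction h arbitrary: v)
  case 0
  then have "w \<noteq> v" "w < n" "v < n" using part w by auto
  then show ?case using A by simp
next
  case (Suc h)
  have lt: "w < n" "v < n" using part w Suc.prems by auto
  have c: "A ^\<^sub>m h \<in> carrier_mat n n" using A by simp
  have "(A ^\<^sub>m h * A) $$ (w, v) = (\<Sum>l = 0..<n. (A ^\<^sub>m h) $$ (w, l) * A $$ (l, v))"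
    using A c lt by (simp add: scalar_prod_def)
  also have "\<dots> = 0"
  proof (intro sum.neutral ballI)
    fix l assume "l \<in> {0..<n}"
    then consider "l \<in> V1" | "l \<in> W" using part by blast
    then show "(A ^\<^sub>m h) $$ (w, l) * A $$ (l, v) = 0"
      by cases (simp_all add: Suc.IH noedge[OF Suc.prems])
  qed
  finally show ?case by simp
qed

text \<open>An empty cutset would give every power of \<open>A\<close> a zero entry, but some power
  is entirely positive. This makes the connectivity positive.\<close>

lemma not_vertex_cutset_empty_of_primitive:
  assumes A: "A \<in> carrier_mat n n" and prim: "primitive_mat A"
  shows "\<not> vertex_cutset (comm_graph A) {}"
proof
  assume "vertex_cutset (comm_graph A) {}"
  then obtain V1 W where V: "V1 \<noteq> {}" "W \<noteq> {}" "V1 \<inter> W = {}" "V1 \<union> W = {0..<n}"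
    and arcs: "\<forall>v\<in>W. \<forall>w\<in>V1. (v, w) \<notin> parcs (comm_graph A)"
    unfolding vertex_cutset_def using A by (auto simp: comm_graph_def)
  obtain v w where vw: "v \<in> W" "w \<in> V1" using V by auto
  have "v' < n \<and> w' < n" if "v' \<in> W" "w' \<in> V1" for v' w'
    using V that by auto
  then have noedge: "A $$ (w', v') = 0" if "v' \<in> W" "w' \<in> V1" for v' w'
    using arcs A that by (auto simp: comm_graph_def)
  have "v < n" "w < n" using V vw by auto
  moreover obtain h where "\<forall>i<n. \<forall>j<n. 0 < (A ^\<^sub>m h) $$ (i, j)"
    using prim A unfolding primitive_mat_def by auto
  ultimately show False
    using pow_mat_reducible_entry_zero[OF A V(3,4) noedge vw(2,1), of h] by fastforce
qed

text \<open>Otherwise \<open>i\<close> could be moved from \<open>S\<close> to \<open>V1\<close>,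
  which leaves a smaller cutset.\<close>

lemma minimum_cutset_arc_from:
  assumes min: "\<forall>S'. vertex_cutset G S' \<longrightarrow> card S \<le> card S'"
    and S: "S \<subseteq> pverts G" "finite S"
    and V: "V1 \<noteq> {}" "V3 \<noteq> {}" "V1 \<inter> V3 = {}" "V1 \<union> V3 = pverts G - S"
    and arcs: "\<forall>v\<in>V3. \<forall>w\<in>V1. (v, w) \<notin> parcs G" and i: "i \<in> S"
  shows "\<exists>v\<in>V3. (v, i) \<in> parcs G"
proof (rule ccontr)
  assume none: "\<not> ?thesis"
  have "vertex_cutset G (S - {i})"
    unfolding vertex_cutset_def
  proof
    show "S - {i} \<subseteq> pverts G" using S by auto
    have "insert i V1 \<inter> V3 = {}" "insert i V1 \<union> V3 = pverts G - (S - {i})"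
      using V S i by auto
    moreover have "\<forall>v\<in>V3. \<forall>w\<in>insert i V1. (v, w) \<notin> parcs G"
      using none arcs by auto
    ultimately have "insert i V1 \<noteq> {} \<and> V3 \<noteq> {} \<and> insert i V1 \<inter> V3 = {} \<and>
        insert i V1 \<union> V3 = pverts G - (S - {i}) \<and>
        (\<forall>v\<in>V3. \<forall>w\<in>insert i V1. (v, w) \<notin> parcs G)"
      using V(2) by (intro conjI) (assumption | simp)+
    then show "\<exists>V1 V3. V1 \<noteq> {} \<and> V3 \<noteq> {} \<and> V1 \<inter> V3 = {} \<and>
        V1 \<union> V3 = pverts G - (S - {i}) \<and> (\<forall>v\<in>V3. \<forall>w\<in>V1. (v, w) \<notin> parcs G)"
      by (intro exI)
  qed
  then have "card S \<le> card (S - {i})" using min by simp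
  then show False using card_Diff1_less[OF S(2) i] by simp
qed

lemma unidentifiableI:
  assumes "K1 \<in> \<K>" "K1 \<noteq> {}" "is_input K1 u1" "K2 \<in> \<K>" "K2 \<noteq> K1" "is_input K2 u2"
    and "x1 \<in> carrier_vec (dim_row A)" "x2 \<in> carrier_vec (dim_row A)" "j \<in> pverts (comm_graph A)"
    and "\<And>t. node_output A j K1 x1 u1 t = node_output A j K2 x2 u2 t"
  shows "unidentifiable A \<K> K1 u1"
  using assms unfolding unidentifiable_def by blast

section \<open>Choice of the two sets and of the inputs\<close>

theorem mainTheorem3:
  fixes A :: "real mat" and n k m :: nat and \<K> :: "nat set set"
  assumes "consensus_mat n A"
    and "has_connectivity (comm_graph A) k"
    and "int m = \<lfloor>(real k - 1) / 2\<rfloor> + 1"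
    and "\<forall>K\<in>\<K>. K \<subseteq> {0..<n}"
    and "\<forall>K. K \<subseteq> {0..<n} \<and> card K = m \<longrightarrow> K \<in> \<K>"
  shows "\<exists>K1 u. K1 \<subseteq> {0..<n} \<and> card K1 = m \<and> is_input K1 u \<and>
    unidentifiable A \<K> K1 u \<and> (\<forall>i\<in>K1. misbehaving K1 u i)"
proof -
  have A: "A \<in> carrier_mat n n" and prim: "primitive_mat A" and "row_stochastic A"
    using assms(1) unfolding consensus_mat_def by auto
  then have nonneg: "0 \<le> A $$ (i, j)" if "i < n" "j < n" for i j
    using that unfolding row_stochastic_def by auto
  have verts: "pverts (comm_graph A) = {0..<n}" and dA: "dim_row A = n"
    using A by (auto simp: comm_graph_def)
  obtain S where cut: "vertex_cutset (comm_graph A) S" and cardS: "card S = k"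
    and min: "\<forall>S'. vertex_cutset (comm_graph A) S' \<longrightarrow> card S \<le> card S'"
    using assms(2) unfolding has_connectivity_def by auto
  obtain V1 V3 where S: "S \<subseteq> {0..<n}"
    and V: "V1 \<noteq> {}" "V3 \<noteq> {}" "V1 \<inter> V3 = {}" "V1 \<union> V3 = {0..<n} - S"
    and arcs: "\<forall>v\<in>V3. \<forall>w\<in>V1. (v, w) \<notin> parcs (comm_graph A)"
    using cut unfolding vertex_cutset_def verts by auto
  have finS: "finite S" using S finite_subset by blast
  have sub: "V1 \<subseteq> {0..<n}" "V3 \<subseteq> {0..<n}" using V by auto
  have noedge: "A $$ (w, v) = 0" if "v \<in> V3" "w \<in> V1" for v w
  proof -
    have "v < n" "w < n" using that sub by auto
    then show ?thesis using arcs that A by (auto simp: comm_graph_def)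
  qed
  have "S \<noteq> {}" using not_vertex_cutset_empty_of_primitive[OF A prim] cut by auto
  then have "0 < k" using cardS finS by auto
  \<comment> \<open>The floor formula says that \<open>m\<close> is \<open>k / 2\<close> rounded up,
    so removing \<open>m\<close> agents from \<open>S\<close> leaves \<open>m\<close> or
    \<open>m - 1\<close> of them.\<close>
  have "\<lfloor>(real k - 1) / 2\<rfloor> = int m - 1" using assms(3) by simp
  then have "real m - 1 \<le> (real k - 1) / 2" "(real k - 1) / 2 < real m"
    unfolding floor_eq_iff by simp_all
  then have "real (2 * m) \<le> real (k + 1)" "real k < real (2 * m + 1)"
    by simp_all
  then have mk: "k = 2 * m \<or> k + 1 = 2 * m"
    unfolding of_nat_le_iff of_nat_less_iff by linarith
  \<comment> \<open>Positivity of \<open>k\<close> excludes \<open>m = 0\<close>, for which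
    \<open>K1\<close> would be empty and could not be unidentifiable.\<close>
  with \<open>0 < k\<close> have m: "0 < m" "m \<le> k" by auto
  obtain K1 where K1: "K1 \<subseteq> S" "card K1 = m"
    using obtain_subset_with_card_n m(2) cardS by metis
  have cardR: "card (S - K1) = k - m"
    using K1 cardS finS by (simp add: card_Diff_subset finite_subset)
  obtain K2 where K2: "S - K1 \<subseteq> K2" "K2 \<subseteq> {0..<n}" "card K2 = m" "K2 \<noteq> K1"
  proof (cases "k = 2 * m")
    case True
    then have c: "card (S - K1) = m" using cardR by simp
    \<comment> \<open>A nonempty set disjoint from \<open>K1\<close> differs from
      \<open>K1\<close>.\<close>
    then have "S - K1 \<noteq> {}" using m by (metis card.empty less_irrefl)
    then show thesis using that[of "S - K1"] S c by auto
  next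
    \<comment> \<open>The only agent of \<open>S\<close> may already be used up by \<open>K1\<close> (when \<open>k = 1\<close>), so \<open>K2\<close> is filled up
      with an idle agent outside \<open>S\<close>.\<close>
    case False
    obtain v where v: "v \<in> V3" using V by auto
    then have "v \<notin> S" "v < n" using V by auto
    moreover have "card (insert v (S - K1)) = m"
      using False mk cardR m finS \<open>v \<notin> S\<close> by auto
    ultimately show thesis using that[of "insert v (S - K1)"] S K1 by auto
  qed
  \<comment> \<open>The signs are opposite because the second system enters the difference of states
    with a minus sign.\<close>
  define f1 where "f1 = (\<lambda>t i. - (A *\<^sub>v confined_motion A V3 t) $ i)"
  define f2 where "f2 = (\<lambda>t i. if i \<in> S - K1 then (A *\<^sub>v confined_motion A V3 t) $ i else 0)"
  let ?u1 = "input_of K1 f1" and ?u2 = "input_of K2 f2"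
  obtain j where j: "j \<in> V1" using V by auto
  have out: "node_output A j K1 (vec n (indicator V3)) ?u1 t = node_output A j K2 (0\<^sub>v n) ?u2 t" for t
  proof (rule node_output_eqI)
    fix i assume "i \<in> neighbors (comm_graph A) j"
    \<comment> \<open>Since \<open>j\<close> lies in \<open>V1\<close>, none of its in-neighbors
      lies in \<open>V3\<close>, and the confined motion is zero at all of them.\<close>
    then have i: "i < n" "i \<notin> V3"
      using noedge[OF _ j] A by (auto simp: neighbors_def comm_graph_def)
    then show "state A K1 (vec n (indicator V3)) ?u1 t $ i = state A K2 (0\<^sub>v n) ?u2 t $ i"
      using state_diff_eq_confined_motion[OF A S V(3,4) noedge K1(1) K2(1,2) f1_def f2_def i(1)]
        confined_motion_outside[of i A V3 t] dA by simp
  qed (simp_all add: state_dim dA)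
  have mis: "misbehaving K1 ?u1 i" if "i \<in> K1" for i
  proof (rule misbehaving_input_of)
    show "finite K1" using K1 finS finite_subset by blast
    have iS: "i \<in> S" using that K1 by auto
    then have "i < n" using S by auto
    obtain v where v: "v \<in> V3" "(v, i) \<in> parcs (comm_graph A)"
      using minimum_cutset_arc_from[OF min _ finS V(1-3) _ arcs iS] verts S V(4) by auto
    have Av: "v < n" "A $$ (i, v) \<noteq> 0"
      using v A by (auto simp: comm_graph_def)
    \<comment> \<open>At time 0 the input of \<open>i\<close> is minus the total weight that
      \<open>i\<close> receives from \<open>V3\<close>: a sum of nonnegative terms, of which the one
      at \<open>v\<close> is positive.\<close>
    have "(A *\<^sub>v confined_motion A V3 0) $ i = (\<Sum>l = 0..<n. A $$ (i, l) * indicator V3 l)"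
      using A \<open>i < n\<close> by (simp add: scalar_prod_def)
    also have "\<dots> > 0"
    proof (rule sum_pos2[of _ v])
      show "0 < A $$ (i, v) * indicator V3 v"
        using v(1) Av nonneg[OF \<open>i < n\<close> Av(1)] by simp
    qed (use Av nonneg \<open>i < n\<close> in \<open>auto simp: indicator_def\<close>)
    finally show "f1 0 i \<noteq> 0" by (simp add: f1_def)
  qed (rule that)
  have K1V: "K1 \<subseteq> {0..<n}" "K1 \<noteq> {}" using K1 S m by auto
  moreover have "unidentifiable A \<K> K1 ?u1"
  proof (rule unidentifiableI[OF _ _ _ _ _ _ _ _ _ out])
    show "K1 \<in> \<K>" "K2 \<in> \<K>" using assms(5) K1 K1V K2 by auto
    show "j \<in> pverts (comm_graph A)" using j sub verts by auto
  qed (use K1V K2 dA in \<open>simp_all add: is_input_input_of\<close>)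
  ultimately show ?thesis
    using K1 mis is_input_input_of by blast
qed

end
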